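(* Let $\mathscr{M}^1,\mathscr{M}^2$ be two labeled finite-horizon MDPs with common horizon $H$, independent transitions and disjoint sets of atomic propositions $AP^1, AP^2$. For $i\in\{1,2\}$ let $\varphi^i$ be an $\mathrm{LTL}_f$ formula over $AP^i$ with equivalent DFA $\mathscr{A}^i$, and let $\mathscr{M}^{i\times}$ be the constrained product MDP of $\mathscr{M}^i$ and $\mathscr{A}^i$ with constraint reward $c^{\mathscr{M}^{i\times}}$. Let $\varphi^J=\varphi^1\wedge\varphi^2$, let $\mathscr{A}^J$ be a DFA equivalent to $\varphi^J$, and let $\mathscr{M}^{J\times}$ be the constrained product MDP of the joint MDP $\mathscr{M}^J$ and $\mathscr{A}^J$, with constraint reward $c^{\mathscr{M}^{J\times}}$. Let $\delta^1,\delta^2,\delta$ be such that $\delta^1+\delta^2\le\delta$, and for $i\in\{1,2\}$ let $\pi^i$ be a policy for $\mathscr{M}^{i\times}$ such that $$\mathcal{R}^{\mathscr{M}^{1\times}}_{\pi^1}(c^{\mathscr{M}^{1\times}})\ge 1-\delta^1,\qquad \mathcal{R}^{\mathscr{M}^{2\times}}_{\pi^2}(c^{\mathscr{M}^{2\times}})\ge 1-\delta^2 .$$ Then the joint execution $\pi=(\pi^1,\pi^2)$ of the two independent policies satisfies the specification $\varphi^J$ with probability at least $1-\delta$, i.e., $$\mathcal{R}^{\mathscr{M}^{J\times}}_{\pi}(c^{\mathscr{M}^{J\times}})\ge 1-\delta .$$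
   Context: **MDPs.** For $i\in\{1,2\}$, $\mathscr{M}^i=(S^i,A^i,H,s^i_1,P^i,AP^i,L^i)$, where $S^i,A^i$ are finite state and action sets, $H\in\mathbb{N}$, $H\geq 1$, is the horizon, $s^i_1\in S^i$ is the initial state, $P^i_h(s'|s,a)$ is the probability of moving to $s'$ when action $a$ is taken in $s$ at time $h\in\{1,\dots,H\}$, $AP^i$ is a finite set of atomic propositions, and $L^i:S^i\to 2^{AP^i}$ is a labeling function. **Joint MDP.** $\mathscr{M}^J$ has state space $S^1\times S^2$, action space $A^1\times A^2$, horizon $H$, initial state $(s^1_1,s^2_1)$, transition probabilities $P_h((t^1,t^2)|(s^1,s^2),(a^1,a^2))=P^1_h(t^1|s^1,a^1)\,P^2_h(t^2|s^2,a^2)$, atomic propositions $AP^1\cup AP^2$, and labels $L^J((s^1,s^2))=L^1(s^1)\cup L^2(s^2)$. **$\mathrm{LTL}_f$.** Formulae over $AP$ are generated by $\varphi:=\mathsf{true}\mid a\mid\neg\varphi\mid\varphi_1\wedge\varphi_2\mid\mathbf{X}\varphi\mid\varphi_1\mathbf{U}\varphi_2$ with $a\in AP$, and are interpreted over finite words $w=w_1\dots w_n$ with $w_k\subseteq AP$, with the standard finite-trace semantics: $w,k\models a$ iff $a\in w_k$; Boolean connectives as usual; $w,k\models\mathbf{X}\varphi$ iff $k<n$ and $w,k+1\models\varphi$; $w,k\models\varphi_1\mathbf{U}\varphi_2$ iff there is $j$ with $k\le j\le n$, $w,j\models\varphi_2$ and $w,m\models\varphi_1$ for all $k\le m<j$.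 We write $w\models\varphi$ iff $w,1\models\varphi$. A run $(s_1,a_1)\dots(s_H,a_H)$ of an MDP with labeling $L$ satisfies $\varphi$ if the word $L(s_1)\dots L(s_H)$ satisfies $\varphi$. **DFA.** A DFA is $\mathscr{A}=(Q,2^{AP},q_0,\delta_{\mathscr{A}},F)$ with finite state set $Q$, initial state $q_0$, transition function $\delta_{\mathscr{A}}:Q\times 2^{AP}\to Q$ and accepting set $F\subseteq Q$. It is equivalent to $\varphi$ if it accepts exactly the words satisfying $\varphi$. **Constrained product MDP.** Given an MDP $\mathscr{M}$ with data $S,A,H,s_1,P,L$ and a DFA $\mathscr{A}$ over the alphabet $2^{AP}$, the product $\mathscr{M}^\times$ has state space $S\times Q$, action set $A$, horizon $H+1$, initial state $(s_1,q_0)$, and, for $h\in\{1,\dots,H\}$, transitions $P^\times_h((s',q')|(s,q),a)=P_h(s'|s,a)$ if $q'=\delta_{\mathscr{A}}(q,L(s))$ and $0$ otherwise. Its constraint reward is $c^\times_h((s,q),a)=1$ if $h=H+1$ and $q\in F$, and $0$ otherwise. For $\mathscr{M}^{i\times}$ and $\mathscr{M}^{J\times}$ this reward is denoted $c^{\mathscr{M}^{i\times}}$ and $c^{\mathscr{M}^{J\times}}$. **Policies and total reward.** A policy for $\mathscr{M}^{i\times}$ is $\pi^i=(\pi^i_1,\dots,\pi^i_{H+1})$ with each $\pi^i_h$ mapping $S^i\times Q^i$ to probability distributions on $A^i$. $\mathcal{R}^{\mathscr{M}^{i\times}}_{\pi^i}(c)=\mathbb{E}\big[\sum_{h=1}^{H+1}c_h((s_h,q_h),a_h)\big]$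 is the total expected reward of an episode under $\pi^i$. **Joint execution.** Under $\pi=(\pi^1,\pi^2)$ each agent $i$ applies $\pi^i$ to its own product state $(s^i_h,q^i_h)$ in $\mathscr{M}^{i\times}$; the two agents' action randomizations and state transitions are independent, so the two agents' trajectories are independent, each distributed as in $\mathscr{M}^{i\times}$ under $\pi^i$. Along the joint trajectory the state of $\mathscr{A}^J$ evolves by $q^J_1=q^J_0$ (the initial state of $\mathscr{A}^J$) and $q^J_{h+1}=\delta_{\mathscr{A}^J}(q^J_h,L^J((s^1_h,s^2_h)))$. The quantity $\mathcal{R}^{\mathscr{M}^{J\times}}_{\pi}(c^{\mathscr{M}^{J\times}})$ is the expected total constraint reward of this joint process, i.e. the probability that $q^J_{H+1}$ is an accepting state of $\mathscr{A}^J$. *)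

theory Defs
  imports "HOL-Probability.Probability"
begin

section \<open>Markov decision processes, episodes and rewards\<close>

text \<open>
  State, action and automaton-state sets are whole types; the definitions do not need them to be
  finite, so finiteness is imposed by sort constraints where results are stated. Transition kernels
  and policies take values in \<^typ>\<open>'a pmf\<close>, hence are stochastic by typing. Times are
  1-based; the values of kernels, policies and rewards at times outside the horizon are never used.
\<close>

record ('s, 'a) mdp =
  mdp_horizon :: nat
  mdp_init :: 's
  mdp_trans :: "nat \<Rightarrow> 's \<Rightarrow> 'a \<Rightarrow> 's pmf"

record ('s, 'a, 'p) lmdp = "('s, 'a) mdp" +
  mdp_props :: "'p set"
  mdp_label :: "'s \<Rightarrow> 'p set"

definition labeled_mdp :: "('s, 'a, 'p) lmdp \<Rightarrow> bool" where
  "labeled_mdp M \<longleftrightarrow>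
     mdp_horizon M \<ge> 1 \<and> finite (mdp_props M) \<and> (\<forall>s. mdp_label M s \<subseteq> mdp_props M)"

type_synonym ('s, 'a) policy = "nat \<Rightarrow> 's \<Rightarrow> 'a pmf"

text \<open>
  \<open>episode_from M \<pi> n h s\<close> is the law of \<open>(s\<^sub>h,a\<^sub>h),\<dots>,(s\<^sub>h\<^sub>+\<^sub>n,a\<^sub>h\<^sub>+\<^sub>n)\<close> given \<open>s\<^sub>h = s\<close>. An action is
  also drawn in the last state, but no transition is taken from there.
\<close>

primrec episode_from ::
  "('s, 'a) mdp \<Rightarrow> ('s, 'a) policy \<Rightarrow> nat \<Rightarrow> nat \<Rightarrow> 's \<Rightarrow> ('s \<times> 'a) list pmf" where
  "episode_from M \<pi> 0 h s = map_pmf (\<lambda>a. [(s, a)]) (\<pi> h s)"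
| "episode_from M \<pi> (Suc n) h s =
     bind_pmf (\<pi> h s) (\<lambda>a.
       bind_pmf (mdp_trans M h s a) (\<lambda>s'.
         map_pmf (\<lambda>\<tau>. (s, a) # \<tau>) (episode_from M \<pi> n (Suc h) s')))"

definition episode :: "('s, 'a) mdp \<Rightarrow> ('s, 'a) policy \<Rightarrow> ('s \<times> 'a) list pmf" where
  "episode M \<pi> = episode_from M \<pi> (mdp_horizon M - 1) 1 (mdp_init M)"

definition expected_reward ::
  "nat \<Rightarrow> (nat \<Rightarrow> 's \<Rightarrow> 'a \<Rightarrow> real) \<Rightarrow> ('s \<times> 'a) list pmf \<Rightarrow> real" where
  "expected_reward N c D =
     measure_pmf.expectation D (\<lambda>\<tau>. \<Sum>h = 1..N. c h (fst (\<tau> ! (h - 1))) (snd (\<tau> ! (h - 1))))"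

definition total_reward ::
  "('s, 'a) mdp \<Rightarrow> ('s, 'a) policy \<Rightarrow> (nat \<Rightarrow> 's \<Rightarrow> 'a \<Rightarrow> real) \<Rightarrow> real" where
  "total_reward M \<pi> c = expected_reward (mdp_horizon M) c (episode M \<pi>)"

definition joint_mdp ::
  "('s1, 'a1, 'p) lmdp \<Rightarrow> ('s2, 'a2, 'p) lmdp \<Rightarrow> ('s1 \<times> 's2, 'a1 \<times> 'a2, 'p) lmdp" where
  "joint_mdp M1 M2 =
     \<lparr> mdp_horizon = mdp_horizon M1,
       mdp_init = (mdp_init M1, mdp_init M2),
       mdp_trans = (\<lambda>h (s1, s2) (a1, a2).
         pair_pmf (mdp_trans M1 h s1 a1) (mdp_trans M2 h s2 a2)),
       mdp_props = mdp_props M1 \<union> mdp_props M2,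
       mdp_label = (\<lambda>(s1, s2). mdp_label M1 s1 \<union> mdp_label M2 s2) \<rparr>"

lemma pmf_joint_mdp_trans:
  "pmf (mdp_trans (joint_mdp M1 M2) h (s1, s2) (a1, a2)) (t1, t2) =
     pmf (mdp_trans M1 h s1 a1) t1 * pmf (mdp_trans M2 h s2 a2) t2"
  by (simp add: joint_mdp_def pmf_pair)

section \<open>Linear temporal logic on finite words\<close>

datatype 'p ltlf =
    LTrue
  | LAtom 'p
  | LNot "'p ltlf"
  | LAnd "'p ltlf" "'p ltlf"
  | LNext "'p ltlf"
  | LUntil "'p ltlf" "'p ltlf"

abbreviation ltlf_over :: "'p set \<Rightarrow> 'p ltlf \<Rightarrow> bool" where
  "ltlf_over AP \<phi> \<equiv> set_ltlf \<phi> \<subseteq> AP"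

text \<open>Positions are 1-based: the letter at position \<open>k\<close> of the list \<open>w\<close> is \<open>w ! (k - 1)\<close>.\<close>

primrec ltlf_sat_at :: "'p set list \<Rightarrow> nat \<Rightarrow> 'p ltlf \<Rightarrow> bool" where
  "ltlf_sat_at w k LTrue \<longleftrightarrow> True"
| "ltlf_sat_at w k (LAtom a) \<longleftrightarrow> a \<in> w ! (k - 1)"
| "ltlf_sat_at w k (LNot \<phi>) \<longleftrightarrow> \<not> ltlf_sat_at w k \<phi>"
| "ltlf_sat_at w k (LAnd \<phi> \<psi>) \<longleftrightarrow> ltlf_sat_at w k \<phi> \<and> ltlf_sat_at w k \<psi>"
| "ltlf_sat_at w k (LNext \<phi>) \<longleftrightarrow> k < length w \<and> ltlf_sat_at w (k + 1) \<phi>"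
| "ltlf_sat_at w k (LUntil \<phi> \<psi>) \<longleftrightarrow>
     (\<exists>j. k \<le> j \<and> j \<le> length w \<and> ltlf_sat_at w j \<psi> \<and>
          (\<forall>m. k \<le> m \<and> m < j \<longrightarrow> ltlf_sat_at w m \<phi>))"

definition ltlf_sat :: "'p set list \<Rightarrow> 'p ltlf \<Rightarrow> bool" where
  "ltlf_sat w \<phi> \<longleftrightarrow> ltlf_sat_at w 1 \<phi>"

definition run_sat :: "('s \<Rightarrow> 'p set) \<Rightarrow> ('s \<times> 'a) list \<Rightarrow> 'p ltlf \<Rightarrow> bool" where
  "run_sat L \<rho> \<phi> \<longleftrightarrow> ltlf_sat (map (\<lambda>(s, a). L s) \<rho>) \<phi>"

section \<open>Automata and constrained products\<close>

text \<open>
  The transition function is total on \<^typ>\<open>'p set\<close>. For an automaton over the alphabet \<open>Pow AP\<close>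
  only its values on letters \<open>\<subseteq> AP\<close> matter, and \<open>dfa_equiv AP\<close> constrains only these.
\<close>

record ('q, 'p) dfa =
  dfa_init :: 'q
  dfa_trans :: "'q \<Rightarrow> 'p set \<Rightarrow> 'q"
  dfa_final :: "'q set"

definition dfa_accepts :: "('q, 'p) dfa \<Rightarrow> 'p set list \<Rightarrow> bool" where
  "dfa_accepts A w \<longleftrightarrow> foldl (dfa_trans A) (dfa_init A) w \<in> dfa_final A"

text \<open>
  The finite-trace semantics has no first position to refer to in the empty word, so equivalence
  speaks of nonempty words only and leaves acceptance of the empty word open.
\<close>

definition dfa_equiv :: "'p set \<Rightarrow> ('q, 'p) dfa \<Rightarrow> 'p ltlf \<Rightarrow> bool" where
  "dfa_equiv AP A \<phi> \<longleftrightarrow>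
     (\<forall>w. w \<noteq> [] \<and> set w \<subseteq> Pow AP \<longrightarrow> (dfa_accepts A w \<longleftrightarrow> ltlf_sat w \<phi>))"

definition product_mdp ::
  "('s, 'a, 'p) lmdp \<Rightarrow> ('q, 'p) dfa \<Rightarrow> ('s \<times> 'q, 'a) mdp" where
  "product_mdp M A =
     \<lparr> mdp_horizon = mdp_horizon M + 1,
       mdp_init = (mdp_init M, dfa_init A),
       mdp_trans = (\<lambda>h (s, q) a.
         map_pmf (\<lambda>s'. (s', dfa_trans A q (mdp_label M s))) (mdp_trans M h s a)) \<rparr>"

lemma pmf_product_mdp_trans:
  "pmf (mdp_trans (product_mdp M A) h (s, q) a) (s', q') =
     (if q' = dfa_trans A q (mdp_label M s) then pmf (mdp_trans M h s a) s' else 0)"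
proof -
  let ?f = "\<lambda>t. (t, dfa_trans A q (mdp_label M s))"
  have "inj ?f" by (simp add: inj_on_def)
  from pmf_map_inj'[OF this]
  have "pmf (map_pmf ?f (mdp_trans M h s a)) (?f s') = pmf (mdp_trans M h s a) s'" .
  moreover have "pmf (map_pmf ?f (mdp_trans M h s a)) (s', q') = 0"
    if "q' \<noteq> dfa_trans A q (mdp_label M s)"
    using that by (intro pmf_map_outside) auto
  ultimately show ?thesis by (auto simp: product_mdp_def)
qed

definition constraint_reward ::
  "('s, 'a, 'p) lmdp \<Rightarrow> ('q, 'p) dfa \<Rightarrow> nat \<Rightarrow> 's \<times> 'q \<Rightarrow> 'a \<Rightarrow> real" where
  "constraint_reward M A = (\<lambda>h (s, q) a.
     if h = mdp_horizon M + 1 \<and> q \<in> dfa_final A then 1 else 0)"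

section \<open>Joint execution\<close>

text \<open>
  Policy \<open>\<pi>i\<close> reads the state of the automaton \<open>Ai\<close>, which is not part of the state of
  \<open>product_mdp (joint_mdp M1 M2) AJ\<close>. The process is therefore run with the states of \<open>A1\<close> and
  \<open>A2\<close> carried along as memory, and the memory is dropped from the resulting trajectory. The
  two action draws and the two state transitions are independent at each step
  (\<^const>\<open>pair_pmf\<close> here and in \<^const>\<open>joint_mdp\<close>).
\<close>

definition joint_execution_mdp ::
  "('s1, 'a1, 'p) lmdp \<Rightarrow> ('s2, 'a2, 'p) lmdp \<Rightarrow> ('q1, 'p) dfa \<Rightarrow> ('q2, 'p) dfa \<Rightarrow>
   ('qJ, 'p) dfa \<Rightarrow> ((('s1 \<times> 's2) \<times> 'qJ) \<times> ('q1 \<times> 'q2), 'a1 \<times> 'a2) mdp" where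
  "joint_execution_mdp M1 M2 A1 A2 AJ =
     (let MJx = product_mdp (joint_mdp M1 M2) AJ in
     \<lparr> mdp_horizon = mdp_horizon MJx,
       mdp_init = (mdp_init MJx, (dfa_init A1, dfa_init A2)),
       mdp_trans = (\<lambda>h (((s1, s2), qJ), (q1, q2)) a.
         map_pmf (\<lambda>x'. (x', (dfa_trans A1 q1 (mdp_label M1 s1), dfa_trans A2 q2 (mdp_label M2 s2))))
           (mdp_trans MJx h ((s1, s2), qJ) a)) \<rparr>)"

definition joint_policy ::
  "('s1 \<times> 'q1, 'a1) policy \<Rightarrow> ('s2 \<times> 'q2, 'a2) policy \<Rightarrow>
   ((('s1 \<times> 's2) \<times> 'qJ) \<times> ('q1 \<times> 'q2), 'a1 \<times> 'a2) policy" where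
  "joint_policy \<pi>1 \<pi>2 = (\<lambda>h (((s1, s2), qJ), (q1, q2)).
     pair_pmf (\<pi>1 h (s1, q1)) (\<pi>2 h (s2, q2)))"

definition joint_episode ::
  "('s1, 'a1, 'p) lmdp \<Rightarrow> ('s2, 'a2, 'p) lmdp \<Rightarrow> ('q1, 'p) dfa \<Rightarrow> ('q2, 'p) dfa \<Rightarrow>
   ('qJ, 'p) dfa \<Rightarrow> ('s1 \<times> 'q1, 'a1) policy \<Rightarrow> ('s2 \<times> 'q2, 'a2) policy \<Rightarrow>
   ((('s1 \<times> 's2) \<times> 'qJ) \<times> ('a1 \<times> 'a2)) list pmf" where
  "joint_episode M1 M2 A1 A2 AJ \<pi>1 \<pi>2 =
     map_pmf (map (\<lambda>((x, m), a). (x, a)))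
       (episode (joint_execution_mdp M1 M2 A1 A2 AJ) (joint_policy \<pi>1 \<pi>2))"

definition joint_total_reward ::
  "('s1, 'a1, 'p) lmdp \<Rightarrow> ('s2, 'a2, 'p) lmdp \<Rightarrow> ('q1, 'p) dfa \<Rightarrow> ('q2, 'p) dfa \<Rightarrow>
   ('qJ, 'p) dfa \<Rightarrow> ('s1 \<times> 'q1, 'a1) policy \<Rightarrow> ('s2 \<times> 'q2, 'a2) policy \<Rightarrow>
   (nat \<Rightarrow> ('s1 \<times> 's2) \<times> 'qJ \<Rightarrow> 'a1 \<times> 'a2 \<Rightarrow> real) \<Rightarrow> real" where
  "joint_total_reward M1 M2 A1 A2 AJ \<pi>1 \<pi>2 c =
     expected_reward (mdp_horizon (product_mdp (joint_mdp M1 M2) AJ)) c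
       (joint_episode M1 M2 A1 A2 AJ \<pi>1 \<pi>2)"

text \<open>
  The run of \<open>M\<close> underlying a trajectory of a product has length \<open>H\<close>: the last state of the
  trajectory, at time \<open>H + 1\<close>, does not contribute a letter.
\<close>

definition underlying_run ::
  "('s, 'a, 'p) lmdp \<Rightarrow> (('s \<times> 'q) \<times> 'a) list \<Rightarrow> ('s \<times> 'a) list" where
  "underlying_run M \<tau> = map (\<lambda>((s, q), a). (s, a)) (take (mdp_horizon M) \<tau>)"

end

(* Projecting the joint process onto agent i gives exactly the product episode of agent i, so the
   union bound makes both automata A1 and A2 accept with probability at least 1 - delta. On every
   trajectory in the support the automaton components are the runs of A1, A2 and AJ on the words
   read so far, and since AP1 and AP2 are disjoint the letters of agent i are the joint letters
   intersected with APi. An LTLf formula over APi cannot see the difference, so acceptance by A1 and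
   A2 is satisfaction of the conjunction by the joint run. *)
theory Submission imports Defs
begin

text \<open>Only atoms inspect letters, and the atoms of \<open>\<phi>\<close> lie in
  \<open>AP\<close>. The bounds on \<open>k\<close> put the index \<open>k - 1\<close> inside
  \<open>w\<close>, where \<open>map\<close> commutes with \<open>!\<close>.\<close>

lemma ltlf_sat_at_restrict:
  assumes "ltlf_over AP \<phi>" "1 \<le> k" "k \<le> length w"
  shows "ltlf_sat_at (map (\<lambda>l. l \<inter> AP) w) k \<phi> \<longleftrightarrow> ltlf_sat_at w k \<phi>"
  using assms
proof (induction \<phi> arbitrary: k)
  case (LUntil \<phi> \<psi>)
  have "ltlf_sat_at (map (\<lambda>l. l \<inter> AP) w) j \<phi> \<longleftrightarrow> ltlf_sat_at w j \<phi>"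
    "ltlf_sat_at (map (\<lambda>l. l \<inter> AP) w) j \<psi> \<longleftrightarrow> ltlf_sat_at w j \<psi>"
    if "k \<le> j" "j \<le> length w" for j
    using LUntil.IH[of j] LUntil.prems that by auto
  \<comment> \<open>The left operand of the until is evaluated at positions below \<open>j\<close>,
    so these too stay within the word and the induction hypothesis covers them.\<close>
  moreover have "m \<le> length w" if "m < j" "j \<le> length w" for m j
    using that by simp
  ultimately show ?case
    unfolding ltlf_sat_at.simps length_map by (meson order.trans)
qed auto

lemma ltlf_sat_restrict:
  assumes "ltlf_over AP \<phi>" "w \<noteq> []"
  shows "ltlf_sat (map (\<lambda>l. l \<inter> AP) w) \<phi> \<longleftrightarrow> ltlf_sat w \<phi>"
  using assms by (simp add: ltlf_sat_def ltlf_sat_at_restrict Suc_le_eq)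

text \<open>Lumpability: the images of the next action and the next state depend on the current
  state only through \<open>f\<close>, so the image process is itself an episode. This yields the
  marginals of the joint execution.\<close>

lemma map_episode_from:
  assumes policy: "\<And>h s. map_pmf g (\<pi> h s) = \<pi>' h (f s)"
    and trans: "\<And>h s a. map_pmf f (mdp_trans M h s a) = mdp_trans M' h (f s) (g a)"
  shows "map_pmf (map (map_prod f g)) (episode_from M \<pi> n h s) = episode_from M' \<pi>' n h (f s)"
proof (induction n arbitrary: h s)
  case 0
  show ?case
    by (simp add: policy[symmetric] pmf.map_comp comp_def)
next
  case (Suc n)
  show ?case
    \<comment> \<open>Used from right to left, the assumptions turn every kernel of
      \<open>M'\<close> into an image of one of \<open>M\<close>, after which both sides are the
      same nested bind.\<close>
    by (simp add: policy[symmetric] trans[symmetric] Suc.IH[symmetric] map_bind_pmf bind_map_pmf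
        pmf.map_comp comp_def)
qed

lemma length_episode_from:
  "\<tau> \<in> set_pmf (episode_from M \<pi> n h s) \<Longrightarrow> length \<tau> = Suc n"
  by (induction n arbitrary: h s \<tau>) auto

text \<open>The component \<open>qf\<close> moves deterministically, so on the support it iterates
  \<open>tr\<close>. The state at index \<open>j\<close> has read the letters before it but not its
  own, hence \<open>take j\<close>. Keeping \<open>qf\<close>, \<open>tr\<close> and
  \<open>lf\<close> abstract lets one induction serve all three automata.\<close>

lemma episode_from_tracks_automaton:
  assumes step: "\<And>h s a s'. s' \<in> set_pmf (mdp_trans M h s a) \<Longrightarrow> qf s' = tr (qf s) (lf s)"
    and "\<tau> \<in> set_pmf (episode_from M \<pi> n h s)" "j \<le> n"
  shows "qf (fst (\<tau> ! j)) = foldl tr (qf s) (map (\<lambda>x. lf (fst x)) (take j \<tau>))"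
  using assms(2,3)
proof (induction n arbitrary: h s \<tau> j)
  case (Suc n)
  then obtain a s' \<rho> where \<tau>: "\<tau> = (s, a) # \<rho>"
    and s': "s' \<in> set_pmf (mdp_trans M h s a)"
    and \<rho>: "\<rho> \<in> set_pmf (episode_from M \<pi> n (Suc h) s')"
    by auto
  show ?case
    using Suc.IH[OF \<rho>] Suc.prems(2) step[OF s'] by (cases j) (auto simp: \<tau>)
qed auto

text \<open>Only the last summand, time \<open>H + 1\<close> at list index \<open>H\<close>, can be
  nonzero, so the total reward is an indicator. The law \<open>D\<close> is arbitrary so that the
  joint episode is covered as well as the product episodes.\<close>

lemma expected_constraint_reward:
  "expected_reward (mdp_horizon M + 1) (constraint_reward M A) D =
     measure_pmf.prob D {\<tau>. snd (fst (\<tau> ! mdp_horizon M)) \<in> dfa_final A}"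
proof -
  have "(\<Sum>h = 1..mdp_horizon M + 1.
          constraint_reward M A h (fst (\<tau> ! (h - 1))) (snd (\<tau> ! (h - 1)))) =
        indicator {\<tau>. snd (fst (\<tau> ! mdp_horizon M)) \<in> dfa_final A} \<tau>" for \<tau>
    by (simp add: constraint_reward_def case_prod_beta sum.cl_ivl_Suc indicator_def)
  then show ?thesis
    by (simp add: expected_reward_def)
qed

lemma total_constraint_reward:
  "total_reward (product_mdp M A) \<pi> (constraint_reward M A) =
     measure_pmf.prob (episode (product_mdp M A) \<pi>)
       {\<tau>. snd (fst (\<tau> ! mdp_horizon M)) \<in> dfa_final A}"
  using expected_constraint_reward[of M A] by (simp add: total_reward_def product_mdp_def)

abbreviation project1 :: "(('s1 \<times> 's2) \<times> 'qJ) \<times> ('q1 \<times> 'q2) \<Rightarrow> 's1 \<times> 'q1" where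
  "project1 x \<equiv> (fst (fst (fst x)), fst (snd x))"

abbreviation project2 :: "(('s1 \<times> 's2) \<times> 'qJ) \<times> ('q1 \<times> 'q2) \<Rightarrow> 's2 \<times> 'q2" where
  "project2 x \<equiv> (snd (fst (fst x)), snd (snd x))"

lemma map_fst_comp_pair_pmf: "map_pmf (\<lambda>x. f (fst x)) (pair_pmf p q) = map_pmf f p"
  using arg_cong[OF map_fst_pair_pmf, where f = "map_pmf f"] by (simp only: pmf.map_comp comp_def)

lemma map_snd_comp_pair_pmf: "map_pmf (\<lambda>x. f (snd x)) (pair_pmf p q) = map_pmf f q"
  using arg_cong[OF map_snd_pair_pmf, where f = "map_pmf f"] by (simp only: pmf.map_comp comp_def)

lemma project1_joint_execution:
  "map_pmf (map (map_prod project1 fst))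
     (episode (joint_execution_mdp M1 M2 A1 A2 AJ) (joint_policy \<pi>1 \<pi>2)) =
   episode (product_mdp M1 A1) \<pi>1"
proof -
  let ?MJ = "joint_execution_mdp M1 M2 A1 A2 AJ"
  have "map_pmf fst (joint_policy \<pi>1 \<pi>2 h s) = \<pi>1 h (project1 s)" for h s
    by (simp add: joint_policy_def case_prod_beta map_fst_pair_pmf)
  \<comment> \<open>Given the current state, the successor of \<open>A1\<close> is a constant
    \<open>c\<close> that depends only on the first agent's label, so only the first factor of the
    pair remains.\<close>
  moreover have "map_pmf project1 (mdp_trans ?MJ h s a) =
      mdp_trans (product_mdp M1 A1) h (project1 s) (fst a)" for h s a
    by (simp add: joint_execution_mdp_def product_mdp_def joint_mdp_def case_prod_beta Let_def
        pmf.map_comp comp_def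
        map_fst_comp_pair_pmf[where f = "\<lambda>t. (t, c)" for c])
  ultimately have "map_pmf (map (map_prod project1 fst))
      (episode_from ?MJ (joint_policy \<pi>1 \<pi>2) n h s) =
      episode_from (product_mdp M1 A1) \<pi>1 n h (project1 s)" for n h s
    by (rule map_episode_from)
  then show ?thesis
    by (simp add: episode_def)
      (simp add: joint_execution_mdp_def product_mdp_def joint_mdp_def)
qed

text \<open>The joint MDP takes its horizon from \<open>M1\<close>; equality of the horizons gives
  the projected episode the length expected for \<open>M2\<close>.\<close>

lemma project2_joint_execution:
  assumes "mdp_horizon M1 = mdp_horizon M2"
  shows "map_pmf (map (map_prod project2 snd))
     (episode (joint_execution_mdp M1 M2 A1 A2 AJ) (joint_policy \<pi>1 \<pi>2)) =
   episode (product_mdp M2 A2) \<pi>2"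
proof -
  let ?MJ = "joint_execution_mdp M1 M2 A1 A2 AJ"
  have "map_pmf snd (joint_policy \<pi>1 \<pi>2 h s) = \<pi>2 h (project2 s)" for h s
    by (simp add: joint_policy_def case_prod_beta map_snd_pair_pmf)
  moreover have "map_pmf project2 (mdp_trans ?MJ h s a) =
      mdp_trans (product_mdp M2 A2) h (project2 s) (snd a)" for h s a
    by (simp add: joint_execution_mdp_def product_mdp_def joint_mdp_def case_prod_beta Let_def
        pmf.map_comp comp_def
        map_snd_comp_pair_pmf[where f = "\<lambda>t. (t, c)" for c])
  ultimately have "map_pmf (map (map_prod project2 snd))
      (episode_from ?MJ (joint_policy \<pi>1 \<pi>2) n h s) =
      episode_from (product_mdp M2 A2) \<pi>2 n h (project2 s)" for n h s
    by (rule map_episode_from)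
  then show ?thesis
    by (simp add: episode_def)
      (simp add: joint_execution_mdp_def product_mdp_def joint_mdp_def assms)
qed

lemma joint_execution_tracks_automata:
  fixes M1 :: "('s1, 'a1, 'p) lmdp" and M2 :: "('s2, 'a2, 'p) lmdp"
  assumes \<tau>: "\<tau> \<in> set_pmf (episode (joint_execution_mdp M1 M2 A1 A2 AJ) \<pi>)"
  defines "H \<equiv> mdp_horizon M1"
  defines "x \<equiv> fst (\<tau> ! H)"
  defines "run \<equiv> map (\<lambda>y. fst (fst (fst y))) (take H \<tau>)"
  shows "length \<tau> = Suc H"
    and "fst (snd x) \<in> dfa_final A1 \<longleftrightarrow> dfa_accepts A1 (map (\<lambda>s. mdp_label M1 (fst s)) run)"
    and "snd (snd x) \<in> dfa_final A2 \<longleftrightarrow> dfa_accepts A2 (map (\<lambda>s. mdp_label M2 (snd s)) run)"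
    and "snd (fst x) \<in> dfa_final AJ \<longleftrightarrow> dfa_accepts AJ (map (mdp_label (joint_mdp M1 M2)) run)"
proof -
  let ?MJ = "joint_execution_mdp M1 M2 A1 A2 AJ"
  have \<tau>': "\<tau> \<in> set_pmf (episode_from ?MJ \<pi> H 1
      (((mdp_init M1, mdp_init M2), dfa_init AJ), (dfa_init A1, dfa_init A2)))"
    using \<tau> by (simp add: episode_def joint_execution_mdp_def product_mdp_def joint_mdp_def H_def)
  then show "length \<tau> = Suc H"
    by (rule length_episode_from)
  \<comment> \<open>Says that the component \<open>qf\<close> of the state at time
    \<open>H + 1\<close> results from reading the \<open>H\<close> letters \<open>lf\<close> from
    its initial value.\<close>
  let ?track = "\<lambda>qf tr lf. qf x = foldl tr
      (qf (((mdp_init M1, mdp_init M2), dfa_init AJ), (dfa_init A1, dfa_init A2)))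
      (map (\<lambda>y. lf (fst y)) (take H \<tau>))"
  \<comment> \<open>The instance \<open>j = n = H\<close>; the determinism of the component is left
    open and is proved for each automaton by unfolding the kernel.\<close>
  note tracks = episode_from_tracks_automaton[OF _ \<tau>' order.refl, folded x_def]
  note unfolds = joint_execution_mdp_def product_mdp_def case_prod_beta Let_def
  have "?track (\<lambda>y. fst (snd y)) (dfa_trans A1) (\<lambda>y. mdp_label M1 (fst (fst (fst y))))"
    by (rule tracks) (auto simp: unfolds)
  then show "fst (snd x) \<in> dfa_final A1 \<longleftrightarrow> dfa_accepts A1 (map (\<lambda>s. mdp_label M1 (fst s)) run)"
    by (simp add: dfa_accepts_def run_def comp_def)
  have "?track (\<lambda>y. snd (snd y)) (dfa_trans A2) (\<lambda>y. mdp_label M2 (snd (fst (fst y))))"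
    by (rule tracks) (auto simp: unfolds)
  then show "snd (snd x) \<in> dfa_final A2 \<longleftrightarrow> dfa_accepts A2 (map (\<lambda>s. mdp_label M2 (snd s)) run)"
    by (simp add: dfa_accepts_def run_def comp_def)
  have "?track (\<lambda>y. snd (fst y)) (dfa_trans AJ) (\<lambda>y. mdp_label (joint_mdp M1 M2) (fst (fst y)))"
    by (rule tracks) (auto simp: unfolds)
  then show "snd (fst x) \<in> dfa_final AJ \<longleftrightarrow> dfa_accepts AJ (map (mdp_label (joint_mdp M1 M2)) run)"
    by (simp add: dfa_accepts_def run_def comp_def)
qed

lemma ltlf_sat_joint_word:
  assumes "labeled_mdp M1" "labeled_mdp M2" "mdp_props M1 \<inter> mdp_props M2 = {}"
    and "ltlf_over (mdp_props M1) \<phi>1" "ltlf_over (mdp_props M2) \<phi>2"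
    and "dfa_equiv (mdp_props M1) A1 \<phi>1" "dfa_equiv (mdp_props M2) A2 \<phi>2" "run \<noteq> []"
  shows "ltlf_sat (map (mdp_label (joint_mdp M1 M2)) run) (LAnd \<phi>1 \<phi>2) \<longleftrightarrow>
    dfa_accepts A1 (map (\<lambda>s. mdp_label M1 (fst s)) run) \<and>
    dfa_accepts A2 (map (\<lambda>s. mdp_label M2 (snd s)) run)"
proof -
  let ?w = "map (mdp_label (joint_mdp M1 M2)) run"
  have sub: "mdp_label M1 s \<subseteq> mdp_props M1" "mdp_label M2 t \<subseteq> mdp_props M2" for s t
    using assms(1,2) by (auto simp: labeled_mdp_def)
  \<comment> \<open>A joint letter is a union of two labels; disjointness of the proposition sets
    makes the other agent's label vanish in the intersection.\<close>
  have letters: "map (\<lambda>l. l \<inter> mdp_props M1) ?w = map (\<lambda>s. mdp_label M1 (fst s)) run"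
    "map (\<lambda>l. l \<inter> mdp_props M2) ?w = map (\<lambda>s. mdp_label M2 (snd s)) run"
    using sub assms(3) by (fastforce simp: joint_mdp_def)+
  have "?w \<noteq> []"
    using assms(8) by simp
  note ltlf_sat_restrict[OF assms(4) this, unfolded letters]
    ltlf_sat_restrict[OF assms(5) this, unfolded letters]
  moreover have "dfa_accepts A1 (map (\<lambda>s. mdp_label M1 (fst s)) run) \<longleftrightarrow>
      ltlf_sat (map (\<lambda>s. mdp_label M1 (fst s)) run) \<phi>1"
    using assms(6,8) sub by (auto simp: dfa_equiv_def image_subset_iff)
  moreover have "dfa_accepts A2 (map (\<lambda>s. mdp_label M2 (snd s)) run) \<longleftrightarrow>
      ltlf_sat (map (\<lambda>s. mdp_label M2 (snd s)) run) \<phi>2"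
    using assms(7,8) sub by (auto simp: dfa_equiv_def image_subset_iff)
  ultimately show ?thesis
    by (simp add: ltlf_sat_def)
qed

text \<open>Inclusion-exclusion with the union bounded by 1: the union bound on failures, phrased
  for success probabilities.\<close>

lemma (in prob_space) prob_Int_ge:
  assumes "A \<in> events" "B \<in> events"
  shows "prob A + prob B - 1 \<le> prob (A \<inter> B)"
  using measure_Un3[of A M B] assms prob_le_1[of "A \<union> B"] by (simp add: fmeasurable_eq_sets)

theorem theorem2:
  fixes M1 :: "('s1::finite, 'a1::finite, 'p) lmdp"
    and M2 :: "('s2::finite, 'a2::finite, 'p) lmdp"
    and A1 :: "('q1::finite, 'p) dfa"
    and A2 :: "('q2::finite, 'p) dfa"
    and AJ :: "('qJ::finite, 'p) dfa"
    and \<phi>1 \<phi>2 :: "'p ltlf"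
    and \<pi>1 :: "('s1 \<times> 'q1, 'a1) policy"
    and \<pi>2 :: "('s2 \<times> 'q2, 'a2) policy"
    and \<delta>1 \<delta>2 \<delta> :: real
  assumes "labeled_mdp M1" and "labeled_mdp M2"
    and "mdp_horizon M1 = mdp_horizon M2"
    and "mdp_props M1 \<inter> mdp_props M2 = {}"
    and "ltlf_over (mdp_props M1) \<phi>1" and "ltlf_over (mdp_props M2) \<phi>2"
    and "dfa_equiv (mdp_props M1) A1 \<phi>1" and "dfa_equiv (mdp_props M2) A2 \<phi>2"
    and "dfa_equiv (mdp_props (joint_mdp M1 M2)) AJ (LAnd \<phi>1 \<phi>2)"
    and "\<delta>1 + \<delta>2 \<le> \<delta>"
    and "total_reward (product_mdp M1 A1) \<pi>1 (constraint_reward M1 A1) \<ge> 1 - \<delta>1"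
    and "total_reward (product_mdp M2 A2) \<pi>2 (constraint_reward M2 A2) \<ge> 1 - \<delta>2"
  shows "measure_pmf.prob (joint_episode M1 M2 A1 A2 AJ \<pi>1 \<pi>2)
           {\<tau>. run_sat (mdp_label (joint_mdp M1 M2)) (underlying_run (joint_mdp M1 M2) \<tau>)
                 (LAnd \<phi>1 \<phi>2)} \<ge> 1 - \<delta>
       \<and> joint_total_reward M1 M2 A1 A2 AJ \<pi>1 \<pi>2
           (constraint_reward (joint_mdp M1 M2) AJ) \<ge> 1 - \<delta>"
proof -
  let ?E = "episode (joint_execution_mdp M1 M2 A1 A2 AJ) (joint_policy \<pi>1 \<pi>2)"
  let ?H = "mdp_horizon M1"
  let ?drop = "map (\<lambda>((x, m), a). (x, a)) ::
    (((('s1 \<times> 's2) \<times> 'qJ) \<times> ('q1 \<times> 'q2)) \<times> ('a1 \<times> 'a2)) list \<Rightarrow> _"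
  let ?MJ = "joint_mdp M1 M2"
  let ?sat = "{\<tau> :: ((('s1 \<times> 's2) \<times> 'qJ) \<times> ('a1 \<times> 'a2)) list.
    run_sat (mdp_label ?MJ) (underlying_run ?MJ \<tau>) (LAnd \<phi>1 \<phi>2)}"
  let ?acc = "{\<tau> :: ((('s1 \<times> 's2) \<times> 'qJ) \<times> ('a1 \<times> 'a2)) list.
    snd (fst (\<tau> ! ?H)) \<in> dfa_final AJ}"
  \<comment> \<open>These two events refer to trajectories that still carry the memory;
    \<open>?sat\<close> and \<open>?acc\<close> refer to trajectories after
    \<open>?drop\<close>.\<close>
  let ?acc1 = "{\<tau>. fst (snd (fst (\<tau> ! ?H))) \<in> dfa_final A1}"
  let ?acc2 = "{\<tau>. snd (snd (fst (\<tau> ! ?H))) \<in> dfa_final A2}"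
  have HJ: "mdp_horizon ?MJ = ?H"
    by (simp add: joint_mdp_def)
  have len: "length \<tau> = Suc ?H" if "\<tau> \<in> set_pmf ?E" for \<tau>
    using joint_execution_tracks_automata(1)[OF that] .
  have "measure_pmf.prob (episode (product_mdp M1 A1) \<pi>1)
      {\<tau>. snd (fst (\<tau> ! ?H)) \<in> dfa_final A1} = measure_pmf.prob ?E ?acc1"
    unfolding project1_joint_execution[of M1 M2 A1 A2 AJ \<pi>1 \<pi>2, symmetric] measure_map_pmf
    \<comment> \<open>The events are compared on the support only, where length \<open>H + 1\<close>
      makes index \<open>H\<close> valid and \<open>!\<close> commutes with
      \<open>map\<close>.\<close>
    by (intro measure_pmf.finite_measure_eq_AE) (auto simp: AE_measure_pmf_iff dest!: len)
  then have p1: "measure_pmf.prob ?E ?acc1 \<ge> 1 - \<delta>1"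
    using assms(11) by (simp add: total_constraint_reward)
  have "measure_pmf.prob (episode (product_mdp M2 A2) \<pi>2)
      {\<tau>. snd (fst (\<tau> ! ?H)) \<in> dfa_final A2} = measure_pmf.prob ?E ?acc2"
    unfolding project2_joint_execution[OF assms(3), of A1 A2 AJ \<pi>1 \<pi>2, symmetric] measure_map_pmf
    by (intro measure_pmf.finite_measure_eq_AE) (auto simp: AE_measure_pmf_iff dest!: len)
  then have p2: "measure_pmf.prob ?E ?acc2 \<ge> 1 - \<delta>2"
    using assms(3,12) by (simp add: total_constraint_reward)
  have p12: "1 - \<delta> \<le> measure_pmf.prob ?E (?acc1 \<inter> ?acc2)"
    using measure_pmf.prob_Int_ge[of ?acc1 ?E ?acc2] p1 p2 assms(10) by simp
  have good: "?drop \<tau> \<in> ?sat \<and> ?drop \<tau> \<in> ?acc" if \<tau>: "\<tau> \<in> set_pmf ?E" "\<tau> \<in> ?acc1 \<inter> ?acc2" for \<tau>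
  proof -
    define run where "run = map (\<lambda>y. fst (fst (fst y))) (take ?H \<tau>)"
    let ?w = "map (mdp_label ?MJ) run"
    note tracks = joint_execution_tracks_automata[OF \<tau>(1), folded run_def]
    \<comment> \<open>The horizon is at least 1, so the word is nonempty and the equivalences of
      automata and formulae apply to it.\<close>
    have "run \<noteq> []"
      using assms(1) len[OF \<tau>(1)] by (auto simp: run_def labeled_mdp_def)
    then have sat: "ltlf_sat ?w (LAnd \<phi>1 \<phi>2)"
      using ltlf_sat_joint_word[OF assms(1,2,4-8)] tracks(2,3) \<tau>(2) by auto
    moreover have "set ?w \<subseteq> Pow (mdp_props ?MJ)"
      using assms(1,2) by (fastforce simp: joint_mdp_def labeled_mdp_def)
    ultimately have "dfa_accepts AJ ?w"
      using assms(9) \<open>run \<noteq> []\<close> by (auto simp: dfa_equiv_def)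
    then have "?drop \<tau> \<in> ?acc"
      using tracks(4) len[OF \<tau>(1)] by (simp add: case_prod_beta)
    moreover have "map (\<lambda>(s, a). mdp_label ?MJ s) (underlying_run ?MJ (?drop \<tau>)) = ?w"
      by (simp add: underlying_run_def run_def HJ take_map comp_def case_prod_beta)
    ultimately show ?thesis
      using sat by (simp add: run_sat_def)
  qed
  \<comment> \<open>Kept generic in \<open>X\<close> because the same event, acceptance by both
    \<open>A1\<close> and \<open>A2\<close>, forces the satisfaction of the formula as well as the
    acceptance by \<open>AJ\<close>.\<close>
  have "1 - \<delta> \<le> measure_pmf.prob (joint_episode M1 M2 A1 A2 AJ \<pi>1 \<pi>2) X"
    if "\<And>\<tau>. \<tau> \<in> set_pmf ?E \<Longrightarrow> \<tau> \<in> ?acc1 \<inter> ?acc2 \<Longrightarrow> ?drop \<tau> \<in> X" for X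
  proof -
    have "measure_pmf.prob ?E (?acc1 \<inter> ?acc2) \<le> measure_pmf.prob ?E (?drop -` X)"
      using that by (intro measure_pmf.finite_measure_mono_AE) (auto simp: AE_measure_pmf_iff)
    then show ?thesis
      using p12 by (simp add: joint_episode_def)
  qed
  from this[of ?sat] this[of ?acc] good
  have "1 - \<delta> \<le> measure_pmf.prob (joint_episode M1 M2 A1 A2 AJ \<pi>1 \<pi>2) ?sat"
    "1 - \<delta> \<le> measure_pmf.prob (joint_episode M1 M2 A1 A2 AJ \<pi>1 \<pi>2) ?acc"
    by blast+
  moreover have "joint_total_reward M1 M2 A1 A2 AJ \<pi>1 \<pi>2 (constraint_reward ?MJ AJ) =
      measure_pmf.prob (joint_episode M1 M2 A1 A2 AJ \<pi>1 \<pi>2) ?acc"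
    using expected_constraint_reward[of ?MJ AJ "joint_episode M1 M2 A1 A2 AJ \<pi>1 \<pi>2"]
    by (simp add: joint_total_reward_def product_mdp_def HJ)
  ultimately show ?thesis
    by simp
qed

end
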